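(* Let $(E_J,\Sigma_J,\pi_J^K)_{J,K\in A}$ be a projective family of measurable spaces whose underlying projective family of sets is a perfect inverse system, with projective limit $(E_A,\Sigma_A)$. Let $\{\mu_J\}_{J\in A}$ be a family of signed or complex bounded measures, $\mu_J$ on $(E_J,\Sigma_J)$, satisfying the compatibility condition $\mu_J(B)=\mu_K((\pi^K_J)^{-1}(B))$ for all $J\le K$ and $B\in\Sigma_J$. A necessary condition for the existence of a (signed or complex) bounded measure $\mu$ on $(E_A,\Sigma_A)$ satisfying $$\mu_J(B)=\mu(\pi_J^{-1}(B))\qquad\text{for all } J\in A,\ B\in\Sigma_J,$$ is the uniform bound $$\sup_{J\in A}|\mu_J|<+\infty,$$ where $|\mu_J|$ denotes the total variation of $\mu_J$ (the total variation on all of $E_J$).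
   Context: A directed set $A$ is a partially ordered set $(A,\le)$ such that for all $J,K\in A$ there is $R\in A$ with $J\le R$, $K\le R$. A projective (inverse) family of sets $\{E_J,\pi^K_J\}_{J,K\in A}$ consists of non-empty sets $E_J$ indexed by a non-empty directed set $A$ and, for every $J\le K$, a surjective map $\pi^K_J:E_K\to E_J$, such that $\pi^K_K=\mathrm{id}_{E_K}$ and $\pi^R_J=\pi^K_J\circ\pi^R_K$ for $J\le K\le R$. Its projective limit is $$E_A:=\{(x_J)_{J\in A}\in\prod_{J\in A}E_J : x_J=\pi^K_J(x_K)\ \text{for all } J\le K\},$$ and $\pi_J:E_A\to E_J$ denotes the restriction to $E_A$ of the coordinate projection. The family is a perfect inverse system if every $\pi_J:E_A\to E_J$ is surjective. A projective family of measurable spaces $(E_J,\Sigma_J,\pi^K_J)_{J,K\in A}$ is a projective family of sets in which each $E_J$ carries a $\sigma$-algebra $\Sigma_J$ and each $\pi^K_J$ ($J\le K$) is measurable. Its projective limit is $(E_A,\Sigma_A)$, where $\Sigma_A$ is the trace on $E_A$ of the product $\sigma$-algebra $\bigotimes_{J\in A}\Sigma_J$; equivalently, $\Sigma_A$ is the $\sigma$-algebra on $E_A$ generated by the sets $\pi_J^{-1}(B)$, $J\in A$, $B\in\Sigma_J$. "Bounded" signed or complex measures are countably additive ones of finite total variation. *)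

theory Defs
  imports "HOL-Analysis.Analysis"
begin

locale directed_set =
  fixes A :: "'i set" and le :: "'i \<Rightarrow> 'i \<Rightarrow> bool"
  assumes refl: "reflp_on A le"
    and antisym: "antisymp_on A le"
    and trans: "transp_on A le"
    and directed: "J \<in> A \<Longrightarrow> K \<in> A \<Longrightarrow> \<exists>R\<in>A. le J R \<and> le K R"

text \<open>
  The sets \<open>E J\<close> may be unrelated, but they are represented as subsets of one common type
  (for instance a disjoint union). \<open>p K J\<close> is the map from \<open>E K\<close> to \<open>E J\<close>, relevant only
  for \<open>le J K\<close> and only on \<open>E K\<close>.
\<close>

locale projective_family_sets = directed_set A le
  for A :: "'i set" and le :: "'i \<Rightarrow> 'i \<Rightarrow> bool" +
  fixes E :: "'i \<Rightarrow> 'a set" and p :: "'i \<Rightarrow> 'i \<Rightarrow> 'a \<Rightarrow> 'a"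
  assumes index_nonempty: "A \<noteq> {}"
    and sets_nonempty: "J \<in> A \<Longrightarrow> E J \<noteq> {}"
    and proj_surj: "J \<in> A \<Longrightarrow> K \<in> A \<Longrightarrow> le J K \<Longrightarrow> p K J ` E K = E J"
    and proj_id: "K \<in> A \<Longrightarrow> x \<in> E K \<Longrightarrow> p K K x = x"
    and proj_comp: "J \<in> A \<Longrightarrow> K \<in> A \<Longrightarrow> R \<in> A \<Longrightarrow> le J K \<Longrightarrow> le K R \<Longrightarrow> x \<in> E R
      \<Longrightarrow> p R J x = p K J (p R K x)"

definition proj_limit_set ::
    "'i set \<Rightarrow> ('i \<Rightarrow> 'i \<Rightarrow> bool) \<Rightarrow> ('i \<Rightarrow> 'a set) \<Rightarrow> ('i \<Rightarrow> 'i \<Rightarrow> 'a \<Rightarrow> 'a) \<Rightarrow> ('i \<Rightarrow> 'a) set"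
  where "proj_limit_set A le E p =
    {x \<in> (\<Pi>\<^sub>E J\<in>A. E J). \<forall>J\<in>A. \<forall>K\<in>A. le J K \<longrightarrow> x J = p K J (x K)}"

locale perfect_inverse_system = projective_family_sets A le E p
  for A :: "'i set" and le :: "'i \<Rightarrow> 'i \<Rightarrow> bool"
    and E :: "'i \<Rightarrow> 'a set" and p :: "'i \<Rightarrow> 'i \<Rightarrow> 'a \<Rightarrow> 'a" +
  assumes limit_proj_surj: "J \<in> A \<Longrightarrow> (\<lambda>x. x J) ` proj_limit_set A le E p = E J"

text \<open>
  Here and below a value of type \<open>'a measure\<close> serves only as a measurable space: its
  \<open>emeasure\<close> component is never used.
\<close>

locale projective_family_measurable =
  projective_family_sets A le "\<lambda>J. space (M J)" p
  for A :: "'i set" and le :: "'i \<Rightarrow> 'i \<Rightarrow> bool"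
    and M :: "'i \<Rightarrow> 'a measure" and p :: "'i \<Rightarrow> 'i \<Rightarrow> 'a \<Rightarrow> 'a" +
  assumes proj_measurable: "J \<in> A \<Longrightarrow> K \<in> A \<Longrightarrow> le J K \<Longrightarrow> p K J \<in> measurable (M K) (M J)"

definition proj_limit_space ::
    "'i set \<Rightarrow> ('i \<Rightarrow> 'i \<Rightarrow> bool) \<Rightarrow> ('i \<Rightarrow> 'a measure) \<Rightarrow> ('i \<Rightarrow> 'i \<Rightarrow> 'a \<Rightarrow> 'a)
      \<Rightarrow> ('i \<Rightarrow> 'a) measure"
  where "proj_limit_space A le M p =
    restrict_space (Pi\<^sub>M A M) (proj_limit_set A le (\<lambda>J. space (M J)) p)"

text \<open>
  Signed and complex measures are the instances \<open>'v = real\<close> and \<open>'v = complex\<close> of the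
  following; such a measure on \<open>M\<close> is a set function whose values outside \<open>sets M\<close> are
  irrelevant. The total variation is the supremum over countable measurable partitions.
\<close>

definition total_variation ::
    "'a measure \<Rightarrow> ('a set \<Rightarrow> 'v::real_normed_vector) \<Rightarrow> ennreal"
  where "total_variation M \<mu> =
    (SUP F \<in> {F :: nat \<Rightarrow> 'a set. range F \<subseteq> sets M \<and> disjoint_family F \<and> (\<Union>i. F i) = space M}.
      \<Sum>i. ennreal (norm (\<mu> (F i))))"

text \<open>
  Countable additivity forces \<open>\<mu> {} = 0\<close>, since the constant series of terms
  \<open>\<mu> {}\<close> has to converge.
\<close>

definition bounded_measure ::
    "'a measure \<Rightarrow> ('a set \<Rightarrow> 'v::real_normed_vector) \<Rightarrow> bool"
  where "bounded_measure M \<mu> \<longleftrightarrow>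
    (\<forall>F :: nat \<Rightarrow> 'a set. range F \<subseteq> sets M \<longrightarrow> disjoint_family F \<longrightarrow>
      (\<lambda>i. \<mu> (F i)) sums \<mu> (\<Union>i. F i)) \<and>
    total_variation M \<mu> < \<infinity>"

definition compatible_measures ::
    "'i set \<Rightarrow> ('i \<Rightarrow> 'i \<Rightarrow> bool) \<Rightarrow> ('i \<Rightarrow> 'a measure) \<Rightarrow> ('i \<Rightarrow> 'i \<Rightarrow> 'a \<Rightarrow> 'a)
      \<Rightarrow> ('i \<Rightarrow> 'a set \<Rightarrow> 'v::real_normed_vector) \<Rightarrow> bool"
  where "compatible_measures A le M p \<mu> \<longleftrightarrow>
    (\<forall>J\<in>A. \<forall>K\<in>A. le J K \<longrightarrow>
      (\<forall>B\<in>sets (M J). \<mu> J B = \<mu> K (p K J -` B \<inter> space (M K))))"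

definition limit_measure ::
    "'i set \<Rightarrow> ('i \<Rightarrow> 'i \<Rightarrow> bool) \<Rightarrow> ('i \<Rightarrow> 'a measure) \<Rightarrow> ('i \<Rightarrow> 'i \<Rightarrow> 'a \<Rightarrow> 'a)
      \<Rightarrow> ('i \<Rightarrow> 'a set \<Rightarrow> 'v::real_normed_vector) \<Rightarrow> (('i \<Rightarrow> 'a) set \<Rightarrow> 'v) \<Rightarrow> bool"
  where "limit_measure A le M p \<mu> \<nu> \<longleftrightarrow>
    bounded_measure (proj_limit_space A le M p) \<nu> \<and>
    (\<forall>J\<in>A. \<forall>B\<in>sets (M J).
      \<mu> J B = \<nu> ((\<lambda>x. x J) -` B \<inter> space (proj_limit_space A le M p)))"

end

theory Submission
  imports Defs
begin

text \<open>If a limit measure \<open>\<nu>\<close> exists, each \<open>\<mu> J\<close> is its image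
  under the coordinate projection to index \<open>J\<close>. Passing to an image cannot increase
  total variation: partitions of the target pull back to partitions of the source with the same
  sums, and the source may have further partitions (\<open>total_variation_image_le\<close>). Hence
  the total variation of \<open>\<nu>\<close>, finite and independent of \<open>J\<close>, bounds
  every term of the supremum.\<close>

lemma total_variation_image_le:
  fixes \<nu> :: "'b set \<Rightarrow> 'v::real_normed_vector"
  assumes f: "f \<in> measurable N M"
    and \<mu>: "\<And>B. B \<in> sets M \<Longrightarrow> \<mu> B = \<nu> (f -` B \<inter> space N)"
  shows "total_variation M \<mu> \<le> total_variation N \<nu>"
  unfolding total_variation_def
proof (rule SUP_mono)
  fix F :: "nat \<Rightarrow> 'a set"
  assume "F \<in> {F. range F \<subseteq> sets M \<and> disjoint_family F \<and> (\<Union>i. F i) = space M}"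
  then have F: "range F \<subseteq> sets M" "disjoint_family F" "(\<Union>i. F i) = space M"
    by auto
  \<comment> \<open>The pulled-back partition: it covers \<open>space N\<close> because
    \<open>f\<close> maps into \<open>space M\<close>, and its sum for \<open>\<nu>\<close> agrees
    term by term with that of \<open>F\<close> for \<open>\<mu>\<close>.\<close>
  define G where "G = (\<lambda>i. f -` F i \<inter> space N)"
  have "range G \<subseteq> sets N"
    using F(1) f by (auto simp: G_def intro: measurable_sets)
  moreover have "disjoint_family G"
    using F(2) by (fastforce simp: G_def disjoint_family_on_def)
  moreover have "(\<Union>i. G i) = space N"
    using F(3) measurable_space[OF f] by (fastforce simp: G_def)
  moreover have "\<mu> (F i) = \<nu> (G i)" for i
    using F(1) \<mu> by (auto simp: G_def)
  ultimately show "\<exists>G\<in>{G. range G \<subseteq> sets N \<and> disjoint_family G \<and> (\<Union>i. G i) = space N}.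
      (\<Sum>i. ennreal (norm (\<mu> (F i)))) \<le> (\<Sum>i. ennreal (norm (\<nu> (G i))))"
    by (intro bexI[of _ G]) auto
qed

lemma limit_projection_measurable:
  assumes "J \<in> A"
  shows "(\<lambda>x. x J) \<in> measurable (proj_limit_space A le M p) (M J)"
  unfolding proj_limit_space_def
  using assms by (intro measurable_restrict_space1 measurable_component_singleton)

text \<open>Values lie in an arbitrary real normed space, so that one argument serves both signed
  and complex measures.\<close>

lemma limit_measure_SUP_total_variation_finite:
  fixes \<mu> :: "'i \<Rightarrow> 'a set \<Rightarrow> 'v::real_normed_vector"
  assumes "limit_measure A le M p \<mu> \<nu>"
  shows "(SUP J\<in>A. total_variation (M J) (\<mu> J)) < \<infinity>"
proof -
  have "(SUP J\<in>A. total_variation (M J) (\<mu> J)) \<le> total_variation (proj_limit_space A le M p) \<nu>"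
    using assms
    \<comment> \<open>Here \<open>f\<close> is the evaluation at \<open>J\<close>, and the image
      equation is the second clause of \<open>limit_measure\<close>.\<close>
    by (intro SUP_least total_variation_image_le[OF limit_projection_measurable])
      (auto simp: limit_measure_def)
  also have "\<dots> < \<infinity>"
    using assms by (simp add: limit_measure_def bounded_measure_def)
  finally show ?thesis .
qed

theorem theorem4:
  fixes A :: "'i set"
    and le :: "'i \<Rightarrow> 'i \<Rightarrow> bool"
    and M :: "'i \<Rightarrow> 'a measure"
    and p :: "'i \<Rightarrow> 'i \<Rightarrow> 'a \<Rightarrow> 'a"
  assumes "projective_family_measurable A le M p"
    and "perfect_inverse_system A le (\<lambda>J. space (M J)) p"
  shows
    "(\<forall>\<mu> :: 'i \<Rightarrow> 'a set \<Rightarrow> real.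
        (\<forall>J\<in>A. bounded_measure (M J) (\<mu> J)) \<longrightarrow> compatible_measures A le M p \<mu> \<longrightarrow>
        (\<exists>\<nu>. limit_measure A le M p \<mu> \<nu>) \<longrightarrow>
        (SUP J\<in>A. total_variation (M J) (\<mu> J)) < \<infinity>) \<and>
     (\<forall>\<mu> :: 'i \<Rightarrow> 'a set \<Rightarrow> complex.
        (\<forall>J\<in>A. bounded_measure (M J) (\<mu> J)) \<longrightarrow> compatible_measures A le M p \<mu> \<longrightarrow>
        (\<exists>\<nu>. limit_measure A le M p \<mu> \<nu>) \<longrightarrow>
        (SUP J\<in>A. total_variation (M J) (\<mu> J)) < \<infinity>)"
  by (intro conjI allI impI; elim exE; rule limit_measure_SUP_total_variation_finite)

end
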